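(* Let $P$ be the set of prime numbers. Let $\theta : P\times\{1,2,3,\dots\}\to\mathbb{C}$ and $K : P\times\{1,2,3,\dots\}\to\{0,1,2,\dots\}$ be arbitrary functions, and let $x$ be an indeterminate. For an integer $n\ge 2$ with unique factorization $n=p_1^{n_1}p_2^{n_2}\cdots p_l^{n_l}$ (distinct primes $p_i$, exponents $n_i\ge 1$), put $$\alpha(n)=\theta(p_1,n_1)\,\theta(p_2,n_2)\cdots\theta(p_l,n_l),\qquad \beta(n)=K(p_1,n_1)+K(p_2,n_2)+\cdots+K(p_l,n_l).$$ Then, as an identity of formal Dirichlet series (in the formal variable $k$) with coefficients in $\mathbb{C}[x]$, $$\prod_{p\in P}\left(1+\sum_{m=1}^{\infty}\frac{\theta(p,m)\,x^{K(p,m)}}{p^{mk}}\right)=1+\sum_{n=2}^{\infty}\frac{\alpha(n)\,x^{\beta(n)}}{n^{k}}.$$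
   Context: A formal Dirichlet series with coefficients in a commutative ring $R$ is a function $a:\{1,2,3,\dots\}\to R$, written $\sum_{n\ge1}a(n)/n^k$. Addition is termwise and multiplication is Dirichlet convolution, $(ab)(n)=\sum_{de=n}a(d)b(e)$. The series $1+\sum_{m\ge1}c_m/p^{mk}$ is the one with coefficient $1$ at $n=1$, coefficient $c_m$ at $n=p^m$, and $0$ elsewhere. An infinite product over primes is the coefficientwise limit of the finite products over $p\le y$ as $y\to\infty$, where for each $n$ the coefficient at $n$ is eventually constant in $y$. *)

theory Defs
  imports "HOL-Computational_Algebra.Computational_Algebra" "HOL.Complex"
begin

(* A series is a coefficient function on the positive integers; the value at 0 is pinned to 0
   so that equality of series is equality of the coefficients at n >= 1. *)
typedef (overloaded) 'a fds = "{f :: nat \<Rightarrow> 'a::zero. f 0 = 0}"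
  morphisms fds_nth Abs_fds
  by (rule exI[of _ "\<lambda>_. 0"]) simp

setup_lifting type_definition_fds

lift_definition fds :: "(nat \<Rightarrow> 'a::zero) \<Rightarrow> 'a fds"
  is "\<lambda>f n. if n = 0 then 0 else f n"
  by simp

lemma fds_nth_fds: "fds_nth (fds f) n = (if n = 0 then 0 else f n)"
  by transfer simp

lemma fds_nth_0 [simp]: "fds_nth A 0 = 0"
  by transfer simp

lemma fds_eqI: "(\<And>n. n > 0 \<Longrightarrow> fds_nth A n = fds_nth B n) \<Longrightarrow> A = B"
  by (metis fds_nth_inject ext fds_nth_0 gr0I)

lemma finite_mult_pairs: "n > 0 \<Longrightarrow> finite {(d, e). d * e = (n::nat)}"
  by (rule finite_subset[of _ "{..n} \<times> {..n}"]) auto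

instantiation fds :: (comm_ring_1) comm_ring_1
begin

definition zero_fds :: "'a fds" where
  "0 = fds (\<lambda>_. 0)"

definition one_fds :: "'a fds" where
  "1 = fds (\<lambda>n. if n = 1 then 1 else 0)"

definition plus_fds :: "'a fds \<Rightarrow> 'a fds \<Rightarrow> 'a fds" where
  "A + B = fds (\<lambda>n. fds_nth A n + fds_nth B n)"

definition uminus_fds :: "'a fds \<Rightarrow> 'a fds" where
  "- A = fds (\<lambda>n. - fds_nth A n)"

definition minus_fds :: "'a fds \<Rightarrow> 'a fds \<Rightarrow> 'a fds" where
  "A - B = fds (\<lambda>n. fds_nth A n - fds_nth B n)"

definition times_fds :: "'a fds \<Rightarrow> 'a fds \<Rightarrow> 'a fds" where
  "A * B = fds (\<lambda>n. \<Sum>(d, e) | d * e = n. fds_nth A d * fds_nth B e)"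

instance
proof
  fix a b c :: "'a fds"
  show "a * b * c = a * (b * c)"
  proof (rule fds_eqI)
    fix n :: nat assume n: "n > 0"
    let ?P = "\<lambda>n::nat. {(d, e). d * e = n}"
    let ?a = "fds_nth a" and ?b = "fds_nth b" and ?c = "fds_nth c"
    have fin: "finite (?P n)" by (rule finite_mult_pairs[OF n])
    have "fds_nth (a * b * c) n =
        (\<Sum>(m, e)\<in>?P n. \<Sum>(d, f)\<in>?P m. ?a d * ?b f * ?c e)"
      unfolding times_fds_def using n
      by (auto simp: fds_nth_fds sum_distrib_right split_def intro!: sum.cong)
    also have "\<dots> = (\<Sum>((m, e), (d, f))\<in>(SIGMA u:?P n. ?P (fst u)). ?a d * ?b f * ?c e)"
      using n fin
      by (subst sum.Sigma[symmetric]) (auto simp: split_def intro!: finite_mult_pairs[unfolded split_def])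
    also have "\<dots> = (\<Sum>((d, m), (f, e))\<in>(SIGMA u:?P n. ?P (snd u)). ?a d * (?b f * ?c e))"
      by (rule sum.reindex_bij_witness[
            where j = "\<lambda>((m, e), (d, f)). ((d, f * e), (f, e))"
              and i = "\<lambda>((d, m), (f, e)). ((d * f, e), (d, f))"]) (auto simp: mult_ac)
    also have "\<dots> = (\<Sum>(d, m)\<in>?P n. \<Sum>(f, e)\<in>?P m. ?a d * (?b f * ?c e))"
      using n fin
      by (subst sum.Sigma[symmetric]) (auto simp: split_def intro!: finite_mult_pairs[unfolded split_def])
    also have "\<dots> = fds_nth (a * (b * c)) n"
      unfolding times_fds_def using n
      by (auto simp: fds_nth_fds sum_distrib_left split_def intro!: sum.cong)
    finally show "fds_nth (a * b * c) n = fds_nth (a * (b * c)) n" .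
  qed
  show "a * b = b * a"
    unfolding times_fds_def
    by (rule arg_cong[where f = fds], rule ext,
        rule sum.reindex_bij_witness[where i = prod.swap and j = prod.swap])
       (auto simp: mult_ac)
  show "1 * a = a"
  proof (rule fds_eqI)
    fix n :: nat assume n: "n > 0"
    have "(\<Sum>(d, e) | d * e = n. fds_nth 1 d * fds_nth a e) =
          (\<Sum>(d, e)\<in>{(1, n)}. fds_nth 1 d * fds_nth a e)"
      using n by (intro sum.mono_neutral_right finite_mult_pairs)
                 (auto simp: one_fds_def fds_nth_fds split: if_splits)
    then show "fds_nth (1 * a) n = fds_nth a n"
      using n by (simp add: times_fds_def one_fds_def fds_nth_fds)
  qed
  show "(a + b) * c = a * c + b * c"
    by (rule fds_eqI)
       (auto simp: times_fds_def plus_fds_def fds_nth_fds split_def sum.distrib[symmetric]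
          distrib_right intro!: sum.cong)
  show "(0 :: 'a fds) \<noteq> 1"
  proof
    assume "(0 :: 'a fds) = 1"
    then have "fds_nth (0 :: 'a fds) 1 = fds_nth 1 1" by simp
    then show False by (simp add: zero_fds_def one_fds_def fds_nth_fds)
  qed
qed (rule fds_eqI; simp add: zero_fds_def plus_fds_def minus_fds_def uminus_fds_def fds_nth_fds
       algebra_simps)+

end

(* The series 1 + (\<Sum>m\<ge>1. c m / p^(m k)), meant for p \<ge> 2, where the exponent m is determined
   by p^m. The value c 0 is not used. *)
definition prime_power_series :: "nat \<Rightarrow> (nat \<Rightarrow> 'a::zero_neq_one) \<Rightarrow> 'a fds" where
  "prime_power_series p c = fds (\<lambda>n.
     if n = 1 then 1
     else if \<exists>m\<ge>1. n = p ^ m then c (THE m. m \<ge> 1 \<and> n = p ^ m)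
     else 0)"

definition has_prime_product :: "(nat \<Rightarrow> 'a::comm_ring_1 fds) \<Rightarrow> 'a fds \<Rightarrow> bool" where
  "has_prime_product F A \<longleftrightarrow>
     (\<forall>n\<ge>1. \<forall>\<^sub>F y :: nat in at_top. fds_nth (\<Prod>p | prime p \<and> p \<le> y. F p) n = fds_nth A n)"

definition alpha :: "(nat \<Rightarrow> nat \<Rightarrow> complex) \<Rightarrow> nat \<Rightarrow> complex" where
  "alpha \<theta> n = (\<Prod>p\<in>prime_factors n. \<theta> p (multiplicity p n))"

definition beta :: "(nat \<Rightarrow> nat \<Rightarrow> nat) \<Rightarrow> nat \<Rightarrow> nat" where
  "beta K n = (\<Sum>p\<in>prime_factors n. K p (multiplicity p n))"

end

theory Submission
  imports Defs
begin

text \<open>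
  For a finite set \<open>S\<close> of primes, unique factorization leaves at most one nonzero term in each
  coefficient of the product over \<open>S\<close>: the coefficient at \<open>n\<close> is the product of the local
  coefficients over the primes dividing \<open>n\<close> when all of them lie in \<open>S\<close>, and \<open>0\<close> otherwise.
  Once \<open>y \<ge> n\<close>, all primes dividing \<open>n\<close> are at most \<open>y\<close>, so the coefficient is constant.
\<close>

text \<open>Since \<open>p > 1\<close>, the powers of \<open>p\<close> are pairwise distinct, so the
  \<open>THE\<close> in the definition picks out exactly \<open>m\<close>. The exponent 0 falls
  under the branch for \<open>n = 1\<close>.\<close>

lemma fds_nth_prime_power_series_power:
  assumes "prime p"
  shows "fds_nth (prime_power_series p c) (p ^ m) = (if m = 0 then 1 else c m)"
proof (cases "m = 0")
  case True
  then show ?thesis by (simp add: prime_power_series_def fds_nth_fds)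
next
  case False
  have p: "p > 1" using assms by (rule prime_gt_1_nat)
  have "(THE j. j \<ge> 1 \<and> p ^ m = p ^ j) = m"
    using False p by (intro the_equality) auto
  moreover have "\<exists>j\<ge>1. p ^ m = p ^ j" using False by (intro exI[of _ m]) auto
  ultimately show ?thesis
    using False p by (auto simp: prime_power_series_def fds_nth_fds)
qed

lemma fds_nth_prime_power_series_nonpower:
  assumes "\<And>m. n \<noteq> p ^ m"
  shows "fds_nth (prime_power_series p c) n = 0"
  using assms[of 0] assms by (auto simp: prime_power_series_def fds_nth_fds)

lemma fds_nth_prod_prime_power_series:
  fixes c :: "nat \<Rightarrow> nat \<Rightarrow> 'a::comm_ring_1"
  assumes "finite S" "\<And>p. p \<in> S \<Longrightarrow> prime p" "n > 0"
  shows "fds_nth (\<Prod>p\<in>S. prime_power_series p (c p)) n =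
           (if prime_factors n \<subseteq> S then \<Prod>p\<in>prime_factors n. c p (multiplicity p n) else 0)"
  using assms
proof (induction S arbitrary: n rule: finite_induct)
  case empty
  \<comment> \<open>The empty product is the series \<open>1\<close>, supported at
    \<open>n = 1\<close>, the only positive integer without prime factors.\<close>
  have "prime_factors n = {} \<longleftrightarrow> n = 1"
    using empty.prems by (auto simp: prime_factorization_empty_iff)
  then show ?case by (auto simp: one_fds_def fds_nth_fds)
next
  case (insert p S)
  have p: "prime p" using insert.prems by simp
  let ?F = "prime_power_series p (c p)"
  let ?G = "\<Prod>q\<in>S. prime_power_series q (c q)"
  have IH: "fds_nth ?G k =
      (if prime_factors k \<subseteq> S then \<Prod>q\<in>prime_factors k. c q (multiplicity q k) else 0)"
    if "k > 0" for k
    using insert.IH insert.prems that by blast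
  \<comment> \<open>Split \<open>n\<close> into its exact power of \<open>p\<close> and a cofactor
    \<open>k\<close> prime to \<open>p\<close>; \<open>v = 0\<close> is allowed.\<close>
  define v where "v = multiplicity p n"
  obtain k where n: "n = p ^ v * k" and k: "\<not> p dvd k"
    using multiplicity_decompose'[of n p] insert.prems(2) p not_prime_unit
    unfolding v_def by blast
  have pos: "k > 0" "p > 0" using insert.prems(2) n prime_gt_0_nat[OF p] by (auto intro: gr0I)
  \<comment> \<open>A nonzero term forces \<open>d\<close> to be a power of \<open>p\<close> and the
    primes of \<open>e\<close> to lie in \<open>S\<close>. As \<open>p\<close> is not in
    \<open>S\<close>, it does not divide \<open>e\<close>, so \<open>d\<close> carries the whole
    \<open>p\<close>-part of \<open>n\<close>.\<close>
  have unique: "d = p ^ v \<and> e = k"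
    if de: "d * e = n" and nz: "fds_nth ?F d * fds_nth ?G e \<noteq> 0" for d e
  proof -
    obtain m where d: "d = p ^ m"
      using nz fds_nth_prime_power_series_nonpower[of d p] by (metis mult_zero_left)
    have "e > 0" using de insert.prems(2) by (auto intro: gr0I)
    then have "prime_factors e \<subseteq> S" using nz IH[of e] by (auto split: if_splits)
    then have "\<not> p dvd e" using insert.hyps p \<open>e > 0\<close> by (auto simp: prime_factors_dvd)
    then have "v = m"
      unfolding v_def using de d pos by (intro multiplicity_decomposeI[of n p m e]) auto
    then show ?thesis using de d n pos by auto
  qed
  have "fds_nth (?F * ?G) n = (\<Sum>(d, e) | d * e = n. fds_nth ?F d * fds_nth ?G e)"
    using insert.prems(2) by (simp add: times_fds_def fds_nth_fds)
  also have "\<dots> = (\<Sum>(d, e)\<in>{(p ^ v, k)}. fds_nth ?F d * fds_nth ?G e)"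
  proof (rule sum.mono_neutral_right)
    show "finite {(d, e). d * e = n}" using insert.prems(2) by (rule finite_mult_pairs)
    show "{(p ^ v, k)} \<subseteq> {(d, e). d * e = n}" using n by blast
    show "\<forall>x\<in>{(d, e). d * e = n} - {(p ^ v, k)}. (case x of (d, e) \<Rightarrow> fds_nth ?F d * fds_nth ?G e) = 0"
    proof
      fix x assume x: "x \<in> {(d, e). d * e = n} - {(p ^ v, k)}"
      obtain d e where "x = (d, e)" by (cases x)
      then show "(case x of (d, e) \<Rightarrow> fds_nth ?F d * fds_nth ?G e) = 0"
        using unique[of d e] x by auto
    qed
  qed
  also have "\<dots> = (if v = 0 then 1 else c p v) * fds_nth ?G k"
    by (simp add: fds_nth_prime_power_series_power[OF p])
  finally have coeff: "fds_nth (?F * ?G) n = (if v = 0 then 1 else c p v) * fds_nth ?G k" .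
  have pk: "p \<notin> prime_factors k" using k by auto
  \<comment> \<open>The case split mirrors the one in \<open>coeff\<close>: for \<open>v = 0\<close>
    the new prime adds neither a prime factor nor a local coefficient.\<close>
  have pf: "prime_factors n = (if v = 0 then {} else {p}) \<union> prime_factors k"
    using n p pos by (simp add: prime_factors_product prime_factorization_prime_power)
  have mult: "multiplicity q n = multiplicity q k" if "q \<in> prime_factors k" for q
  proof -
    have "q \<noteq> p" "prime q" using that pk by auto
    then have "multiplicity q (p ^ v) = 0"
      using p by (intro not_dvd_imp_multiplicity_0) (metis prime_dvd_power primes_dvd_imp_eq)
    then show ?thesis
      using n pos \<open>prime q\<close> by (simp add: prime_elem_multiplicity_mult_distrib)
  qed
  have "(\<Prod>q\<in>prime_factors n. c q (multiplicity q n)) =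
      (if v = 0 then 1 else c p v) * (\<Prod>q\<in>prime_factors k. c q (multiplicity q k))"
    using pk mult by (auto simp: pf v_def[symmetric])
  moreover have "prime_factors n \<subseteq> insert p S \<longleftrightarrow> prime_factors k \<subseteq> S"
    using pk by (auto simp: pf)
  ultimately show ?case
    using insert.hyps coeff IH[OF pos(1)] by simp
qed

text \<open>This is why \<open>alpha\<close> is a product while \<open>beta\<close> is a sum. For
  infinite \<open>A\<close> both sides take the default value \<open>1 = monom 1 0\<close>.\<close>

lemma prod_monom: "(\<Prod>i\<in>A. monom (f i) (g i)) = monom (\<Prod>i\<in>A. f i) (\<Sum>i\<in>A. g i)"
  by (induction A rule: infinite_finite_induct) (simp_all add: mult_monom)

theorem theoremE:
  fixes \<theta> :: "nat \<Rightarrow> nat \<Rightarrow> complex" and K :: "nat \<Rightarrow> nat \<Rightarrow> nat"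
  shows "has_prime_product
           (\<lambda>p. prime_power_series p (\<lambda>m. monom (\<theta> p m) (K p m)))
           (fds (\<lambda>n. if n = 1 then 1 else monom (alpha \<theta> n) (beta K n)))"
  unfolding has_prime_product_def
proof (intro allI impI)
  fix n :: nat
  assume n: "n \<ge> 1"
  show "\<forall>\<^sub>F y in at_top.
      fds_nth (\<Prod>p | prime p \<and> p \<le> y. prime_power_series p (\<lambda>m. monom (\<theta> p m) (K p m))) n =
      fds_nth (fds (\<lambda>n. if n = 1 then 1 else monom (alpha \<theta> n) (beta K n))) n"
    using eventually_ge_at_top[of n]
  proof eventually_elim
    case (elim y)
    have "prime_factors n \<subseteq> {p. prime p \<and> p \<le> y}"
      using n elim by (auto dest!: dvd_imp_le simp: prime_factors_dvd)
    then show ?case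
      using n by (subst fds_nth_prod_prime_power_series)
        (auto simp: fds_nth_fds prod_monom alpha_def beta_def)
  qed
qed

end
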